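(* Let $a,b,c,d\in\mathbb R$ be admissible parameters (see context) with $c\neq0$ and $a=b=0$, and let $\lambda>0$, $\sigma\neq0$, $m\in(0,1]$. Define $$j_0=-1,\qquad k_0=-8d\lambda^2m^2\sigma+4d\lambda^2\sigma+\sigma,\qquad k_1=0,\qquad k_2=12\,d\,\lambda^2m^2\sigma .$$ Then, with $\xi=x-\sigma t$, the functions $$\eta=j_0=-1,\qquad w=k_0+k_2\,\mathrm{cn}^2(\lambda\xi,m)$$ form a (semi-trivial) traveling-wave solution of the $abcd$-system.
   Context: The $abcd$-system for real-valued $\eta(x,t),w(x,t)$, $x,t\in\mathbb R$, is $$\eta_t+w_x+(w\eta)_x+a w_{xxx}-b\eta_{xxt}=0,\qquad w_t+\eta_x+ww_x+c\,\eta_{xxx}-d w_{xxt}=0 .$$ The real parameters $a,b,c,d$ are admissible if for some $\theta\in[0,1]$: $a+b=\tfrac12(\theta^2-\tfrac13)$, $c+d=\tfrac12(1-\theta^2)\ge 0$, and $a+b+c+d=\tfrac13$. "Semi-trivial" means that one component is constant. Jacobi elliptic function convention: for $0\le m\le 1$, with $v=\int_0^\phi (1-m^2\sin^2 t)^{-1/2}dt$, one sets $\mathrm{cn}(v,m)=\cos\phi$; $m$ is the elliptic modulus (so $\mathrm{cn}(v,1)=\mathrm{sech}\,v$). *)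

theory Defs
  imports "HOL-Analysis.Analysis"
begin

text \<open>Jacobi elliptic functions; \<open>m\<close> is the elliptic modulus (not the parameter \<open>m\<^sup>2\<close>).\<close>

definition jacobi_integrand :: "real \<Rightarrow> real \<Rightarrow> real" where
  "jacobi_integrand m t = 1 / sqrt (1 - m\<^sup>2 * (sin t)\<^sup>2)"

text \<open>
  The amplitude \<open>\<phi>\<close> is the upper limit at which the oriented integral equals \<open>v\<close>.
  Integrability is demanded explicitly because a divergent integral
  has the value \<open>0\<close> by convention; for \<open>m = 1\<close> it confines \<open>\<phi>\<close> to the open interval
  from \<open>-\<pi>/2\<close> to \<open>\<pi>/2\<close>.  Thus \<open>\<phi>\<close> is unique for every real \<open>v\<close> and \<open>0 \<le> m \<le> 1\<close>.
\<close>

definition jacobi_am :: "real \<Rightarrow> real \<Rightarrow> real" where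
  "jacobi_am v m =
     (THE \<phi>. interval_lebesgue_integrable lborel (ereal 0) (ereal \<phi>) (jacobi_integrand m)
             \<and> v = (LBINT t=ereal 0..ereal \<phi>. jacobi_integrand m t))"

definition jacobi_cn :: "real \<Rightarrow> real \<Rightarrow> real" where
  "jacobi_cn v m = cos (jacobi_am v m)"

definition partial_x :: "(real \<Rightarrow> real \<Rightarrow> real) \<Rightarrow> real \<Rightarrow> real \<Rightarrow> real" where
  "partial_x f x t = deriv (\<lambda>y. f y t) x"

definition partial_t :: "(real \<Rightarrow> real \<Rightarrow> real) \<Rightarrow> real \<Rightarrow> real \<Rightarrow> real" where
  "partial_t f x t = deriv (\<lambda>s. f x s) t"

text \<open>\<open>C_class n f\<close>: all partial derivatives of \<open>f\<close> of order at most \<open>n\<close>, in any order of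
  differentiation, exist everywhere and are jointly continuous.\<close>

primrec C_class :: "nat \<Rightarrow> (real \<Rightarrow> real \<Rightarrow> real) \<Rightarrow> bool" where
  "C_class 0 f \<longleftrightarrow> continuous_on UNIV (\<lambda>(x, t). f x t)"
| "C_class (Suc n) f \<longleftrightarrow>
     continuous_on UNIV (\<lambda>(x, t). f x t)
     \<and> (\<forall>x t. (\<lambda>y. f y t) differentiable (at x) \<and> (\<lambda>s. f x s) differentiable (at t))
     \<and> C_class n (partial_x f) \<and> C_class n (partial_t f)"

text \<open>Solutions are classical and global in \<open>x\<close> and \<open>t\<close>; the system is of third order.  The
  regularity requirement excludes the default values \<open>deriv\<close> takes at points of
  non-differentiability.\<close>

definition abcd_solution ::
  "real \<Rightarrow> real \<Rightarrow> real \<Rightarrow> real \<Rightarrow> (real \<Rightarrow> real \<Rightarrow> real) \<Rightarrow> (real \<Rightarrow> real \<Rightarrow> real) \<Rightarrow> bool" where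
  "abcd_solution a b c d \<eta> w \<longleftrightarrow>
     C_class 3 \<eta> \<and> C_class 3 w \<and>
     (\<forall>x t.
        partial_t \<eta> x t + partial_x w x t + partial_x (\<lambda>x t. w x t * \<eta> x t) x t
          + a * partial_x (partial_x (partial_x w)) x t
          - b * partial_t (partial_x (partial_x \<eta>)) x t = 0
      \<and> partial_t w x t + partial_x \<eta> x t + w x t * partial_x w x t
          + c * partial_x (partial_x (partial_x \<eta>)) x t
          - d * partial_t (partial_x (partial_x w)) x t = 0)"

definition admissible :: "real \<Rightarrow> real \<Rightarrow> real \<Rightarrow> real \<Rightarrow> bool" where
  "admissible a b c d \<longleftrightarrow>
     (\<exists>\<theta>. 0 \<le> \<theta> \<and> \<theta> \<le> 1
        \<and> a + b = 1/2 * (\<theta>\<^sup>2 - 1/3)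
        \<and> c + d = 1/2 * (1 - \<theta>\<^sup>2) \<and> c + d \<ge> 0
        \<and> a + b + c + d = 1/3)"

definition traveling_wave ::
  "real \<Rightarrow> (real \<Rightarrow> real \<Rightarrow> real) \<Rightarrow> (real \<Rightarrow> real \<Rightarrow> real) \<Rightarrow> bool" where
  "traveling_wave \<sigma> \<eta> w \<longleftrightarrow>
     (\<exists>f g. \<forall>x t. \<eta> x t = f (x - \<sigma> * t) \<and> w x t = g (x - \<sigma> * t))"

text \<open>At least one component is constant.\<close>

definition semi_trivial :: "(real \<Rightarrow> real \<Rightarrow> real) \<Rightarrow> (real \<Rightarrow> real \<Rightarrow> real) \<Rightarrow> bool" where
  "semi_trivial \<eta> w \<longleftrightarrow> (\<exists>C. \<forall>x t. \<eta> x t = C) \<or> (\<exists>C. \<forall>x t. w x t = C)"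

end

theory Submission
  imports Defs
begin

text \<open>
  On the set of admissible amplitudes the elliptic integral is a diffeomorphism onto the real line,
  so the amplitude satisfies \<open>am' = sqrt (1 - m\<^sup>2 sin\<^sup>2 am)\<close>.  Hence \<open>y = cn\<^sup>2\<close> satisfies
  \<open>y'' = 2 ((1 - m\<^sup>2) + 2 (2 m\<^sup>2 - 1) y - 3 m\<^sup>2 y\<^sup>2)\<close>, and differentiating once more turns the
  second equation of the system into a relation that is linear in \<open>y\<close>, with a common
  factor \<open>y'\<close>; the values of \<open>k0\<close> and \<open>k2\<close> make its two coefficients vanish.  The first equation
  is trivial because \<open>\<eta> = -1\<close> cancels \<open>w\<^sub>x\<close>.
\<close>

section \<open>The elliptic integral and the amplitude\<close>

text \<open>The upper limits up to which the integrand has no singularity.\<close>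

definition amplitude_domain :: "real \<Rightarrow> real set" where
  "amplitude_domain m = {\<phi>. m < 1 \<or> \<bar>\<phi>\<bar> < pi / 2}"

text \<open>The incomplete elliptic integral of the first kind, in the form in which it occurs in
  \<open>jacobi_am\<close>, so that it can be folded there.\<close>

definition elliptic_F :: "real \<Rightarrow> real \<Rightarrow> real" where
  "elliptic_F m \<phi> = (LBINT t=ereal 0..ereal \<phi>. jacobi_integrand m t)"

lemma open_amplitude_domain: "open (amplitude_domain m)"
proof (cases "m < 1")
  case False
  then have "amplitude_domain m = {-(pi/2)<..<pi/2}"
    by (auto simp: amplitude_domain_def)
  then show ?thesis by simp
qed (simp add: amplitude_domain_def)

lemma amplitude_domain_between:
  assumes "x \<in> amplitude_domain m" "y \<in> amplitude_domain m" "x \<le> t" "t \<le> y"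
  shows "t \<in> amplitude_domain m"
  using assms by (auto simp: amplitude_domain_def)

lemma zero_in_amplitude_domain: "0 \<in> amplitude_domain m"
  by (simp add: amplitude_domain_def)

text \<open>For \<open>m < 1\<close> the subtracted term is at most \<open>m\<^sup>2 < 1\<close>.
  For \<open>m = 1\<close> the radicand is the square of \<open>cos t\<close>, which is positive
  inside the domain.\<close>

lemma jacobi_radicand_pos:
  assumes "0 \<le> m" "m \<le> 1" "t \<in> amplitude_domain m"
  shows "0 < 1 - m\<^sup>2 * (sin t)\<^sup>2"
proof (cases "m < 1")
  case True
  have "m\<^sup>2 * (sin t)\<^sup>2 \<le> m\<^sup>2 * 1"
    by (rule mult_left_mono) (auto simp: abs_square_le_1)
  moreover have "m\<^sup>2 < 1" using True assms by (simp add: abs_square_less_1)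
  ultimately show ?thesis by linarith
next
  case False
  with assms have "m = 1" "cos t > 0"
    by (auto simp: amplitude_domain_def intro: cos_gt_zero_pi)
  then show ?thesis
    by (simp add: sin_squared_eq)
qed

lemma isCont_jacobi_integrand:
  assumes "0 \<le> m" "m \<le> 1" "t \<in> amplitude_domain m"
  shows "isCont (jacobi_integrand m) t"
  using jacobi_radicand_pos[OF assms] unfolding jacobi_integrand_def
  by (intro continuous_intros) auto

lemma jacobi_integrand_pos:
  assumes "0 \<le> m" "m \<le> 1" "t \<in> amplitude_domain m"
  shows "0 < jacobi_integrand m t"
  using jacobi_radicand_pos[OF assms] by (simp add: jacobi_integrand_def)

text \<open>Covers points outside the domain too: at a zero of the radicand, division by zero gives
  0. This allows comparing integrals over intervals that reach past the singularity.\<close>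

lemma jacobi_integrand_nonneg:
  assumes "0 \<le> m" "m \<le> 1"
  shows "0 \<le> jacobi_integrand m t"
proof -
  have "m\<^sup>2 * (sin t)\<^sup>2 \<le> 1 * 1"
    using assms by (intro mult_mono) (auto simp: abs_square_le_1)
  then show ?thesis by (simp add: jacobi_integrand_def)
qed

text \<open>Supplies the linear growth behind surjectivity for \<open>m < 1\<close>.\<close>

lemma jacobi_integrand_ge_1:
  assumes "0 \<le> m" "m \<le> 1" "t \<in> amplitude_domain m"
  shows "1 \<le> jacobi_integrand m t"
proof -
  have "sqrt (1 - m\<^sup>2 * (sin t)\<^sup>2) \<le> 1" by simp
  then show ?thesis
    using jacobi_radicand_pos[OF assms] by (simp add: jacobi_integrand_def)
qed

lemma jacobi_integrand_one:
  assumes "t \<in> amplitude_domain 1"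
  shows "jacobi_integrand 1 t = 1 / cos t"
proof -
  have "cos t > 0"
    using assms by (auto simp: amplitude_domain_def intro: cos_gt_zero_pi)
  then show ?thesis
    by (simp add: jacobi_integrand_def flip: cos_squared_eq)
qed

lemma interval_integrable_jacobi_integrand:
  assumes "0 \<le> m" "m \<le> 1" "\<phi> \<in> amplitude_domain m"
  shows "interval_lebesgue_integrable lborel (ereal 0) (ereal \<phi>) (jacobi_integrand m)"
proof (rule interval_integrable_isCont)
  fix t assume "min 0 \<phi> \<le> t" "t \<le> max 0 \<phi>"
  then have "t \<in> amplitude_domain m"
    using amplitude_domain_between[of 0 m \<phi> t] amplitude_domain_between[of \<phi> m 0 t]
      zero_in_amplitude_domain assms(3) by (cases "0 \<le> \<phi>") auto
  then show "isCont (jacobi_integrand m) t"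
    by (rule isCont_jacobi_integrand[OF assms(1,2)])
qed

section \<open>Derivative, monotonicity and range of the elliptic integral\<close>

lemma elliptic_F_has_derivative:
  assumes m: "0 \<le> m" "m \<le> 1" and \<phi>: "\<phi> \<in> amplitude_domain m"
  shows "(elliptic_F m has_real_derivative jacobi_integrand m \<phi>) (at \<phi>)"
proof -
  \<comment> \<open>The interval must contain the base point 0 as well as \<open>\<phi>\<close>.
    With \<open>\<phi>\<close> in its interior, the derivative within it is the two-sided
    one.\<close>
  obtain a b where ab: "a \<in> amplitude_domain m" "b \<in> amplitude_domain m" "a < 0" "0 < b" "a < \<phi>" "\<phi> < b"
  proof (cases "m < 1")
    case True
    then show ?thesis
      using that[of "- \<bar>\<phi>\<bar> - 1" "\<bar>\<phi>\<bar> + 1"] by (auto simp: amplitude_domain_def)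
  next
    case False
    with \<phi> have "\<bar>\<phi>\<bar> < pi / 2" by (simp add: amplitude_domain_def)
    then obtain c where "\<bar>\<phi>\<bar> < c" "c < pi / 2" using dense by blast
    then show ?thesis
      using that[of "- c" c] by (auto simp: amplitude_domain_def)
  qed
  have "continuous_on {a..b} (jacobi_integrand m)"
    using isCont_jacobi_integrand[OF m] amplitude_domain_between[OF ab(1,2)]
    by (intro continuous_at_imp_continuous_on) auto
  then have "((\<lambda>u. LBINT y=ereal 0..ereal u. jacobi_integrand m y) has_vector_derivative
      jacobi_integrand m \<phi>) (at \<phi> within {a..b})"
    using ab by (intro interval_integral_FTC2) auto
  then have "(elliptic_F m has_real_derivative jacobi_integrand m \<phi>) (at \<phi> within {a..b})"
    unfolding has_real_derivative_iff_has_vector_derivative elliptic_F_def .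
  then show ?thesis
    using ab by (simp add: at_within_Icc_at)
qed

lemma elliptic_F_zero: "elliptic_F m 0 = 0"
  unfolding elliptic_F_def by (simp add: interval_lebesgue_integral_def einterval_same set_lebesgue_integral_def)

lemma elliptic_F_strict_mono:
  assumes m: "0 \<le> m" "m \<le> 1"
  shows "strict_mono_on (amplitude_domain m) (elliptic_F m)"
proof (rule strict_mono_onI)
  fix x y assume xy: "x \<in> amplitude_domain m" "y \<in> amplitude_domain m" "x < y"
  show "elliptic_F m x < elliptic_F m y"
    by (rule DERIV_pos_imp_increasing[OF xy(3)])
      (use elliptic_F_has_derivative[OF m] jacobi_integrand_pos[OF m]
        amplitude_domain_between[OF xy(1,2)] in blast)
qed

text \<open>Here the integrand is the secant, with antiderivative \<open>artanh (sin t)\<close>, the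
  inverse Gudermannian function.\<close>

lemma elliptic_F_one:
  assumes "\<phi> \<in> amplitude_domain 1"
  shows "elliptic_F 1 \<phi> = artanh (sin \<phi>)"
proof -
  have mem: "t \<in> amplitude_domain 1" if "min 0 \<phi> \<le> t" "t \<le> max 0 \<phi>" for t
    using that amplitude_domain_between[of 0 1 \<phi> t] amplitude_domain_between[of \<phi> 1 0 t]
      zero_in_amplitude_domain assms by (cases "0 \<le> \<phi>") auto
  have "elliptic_F 1 \<phi> = artanh (sin \<phi>) - artanh (sin 0)"
    unfolding elliptic_F_def
  proof (rule interval_integral_FTC_finite)
    show "continuous_on {min 0 \<phi>..max 0 \<phi>} (jacobi_integrand 1)"
      using isCont_jacobi_integrand[of 1] mem by (intro continuous_at_imp_continuous_on) auto
  next
    fix t assume "min 0 \<phi> \<le> t" "t \<le> max 0 \<phi>"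
    then have t: "t \<in> amplitude_domain 1" by (rule mem)
    then have c: "cos t > 0" by (auto simp: amplitude_domain_def intro: cos_gt_zero_pi)
    then have "(sin t)\<^sup>2 < 1" by (simp add: sin_squared_eq)
    then have s: "\<bar>sin t\<bar> < 1" by (simp add: abs_square_less_1)
    have "((\<lambda>t. artanh (sin t)) has_real_derivative 1 / (1 - (sin t)\<^sup>2) * cos t)
        (at t within {min 0 \<phi>..max 0 \<phi>})"
      by (rule DERIV_chain2[where f = artanh and g = sin, OF artanh_real_has_field_derivative[OF s]]) (auto intro!: derivative_eq_intros)
    moreover have "1 / (1 - (sin t)\<^sup>2) * cos t = jacobi_integrand 1 t"
      using c t by (simp add: jacobi_integrand_one sin_squared_eq) (simp add: power2_eq_square)
    ultimately show "((\<lambda>t. artanh (sin t)) has_vector_derivative jacobi_integrand 1 t)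
        (at t within {min 0 \<phi>..max 0 \<phi>})"
      by (simp add: has_real_derivative_iff_has_vector_derivative)
  qed
  then show ?thesis by simp
qed

text \<open>For \<open>m = 1\<close> the closed form yields the explicit preimage
  \<open>arcsin (tanh v)\<close>. For \<open>m < 1\<close> the integral grows at least as fast as
  the identity, and the intermediate value theorem applies.\<close>

lemma elliptic_F_surj:
  assumes m: "0 \<le> m" "m \<le> 1"
  obtains \<phi> where "\<phi> \<in> amplitude_domain m" "elliptic_F m \<phi> = v"
proof (cases "m < 1")
  case False
  then have m1: "m = 1" using m by simp
  have th: "- 1 < tanh v" "tanh v < 1" by (rule tanh_real_gt_neg1 tanh_real_lt_1)+
  then have "- (pi / 2) < arcsin (tanh v)" "arcsin (tanh v) < pi / 2"
    using arcsin_lt_bounded by auto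
  then have dom: "arcsin (tanh v) \<in> amplitude_domain m"
    unfolding amplitude_domain_def by (simp add: abs_if)
  show ?thesis
    by (rule that[OF dom]) (use dom m1 th in \<open>simp add: elliptic_F_one artanh_tanh_real\<close>)
next
  case True
  then have dom: "t \<in> amplitude_domain m" for t by (simp add: amplitude_domain_def)
  have cont: "continuous_on A (elliptic_F m)" for A
    using elliptic_F_has_derivative[OF m dom] by (meson DERIV_isCont continuous_at_imp_continuous_on)
  have grow: "elliptic_F m x - x \<le> elliptic_F m y - y" if "x \<le> y" for x y
  proof (rule DERIV_nonneg_imp_nondecreasing[OF that])
    fix t
    have "((\<lambda>t. elliptic_F m t - t) has_real_derivative jacobi_integrand m t - 1) (at t)"
      by (intro derivative_intros elliptic_F_has_derivative m dom)
    then show "\<exists>y. ((\<lambda>t. elliptic_F m t - t) has_real_derivative y) (at t) \<and> 0 \<le> y"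
      using jacobi_integrand_ge_1[OF m dom, of t] by force
  qed
  \<comment> \<open>Since the integral vanishes at 0, \<open>grow\<close> puts its value at
    \<open>\<bar>v\<bar>\<close> above \<open>\<bar>v\<bar>\<close> and its value at
    \<open>- \<bar>v\<bar>\<close> below \<open>- \<bar>v\<bar>\<close>, in the weak sense, so
    \<open>v\<close> lies between them.\<close>
  have "\<exists>\<phi>. - \<bar>v\<bar> \<le> \<phi> \<and> \<phi> \<le> \<bar>v\<bar> \<and> elliptic_F m \<phi> = v"
    using grow[of 0 "\<bar>v\<bar>"] grow[of "- \<bar>v\<bar>" 0] elliptic_F_zero[of m]
    by (intro IVT' cont) auto
  then show ?thesis using that dom by blast
qed

text \<open>For \<open>m = 1\<close> the integral up to \<open>arcsin (tanh v)\<close> equals \<open>v\<close>, so it is unbounded near the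
  singularity at \<open>\<pi>/2\<close>.\<close>

lemma not_interval_integrable_jacobi_integrand:
  assumes m: "0 \<le> m" "m \<le> 1" and \<phi>: "\<phi> \<notin> amplitude_domain m"
  shows "\<not> interval_lebesgue_integrable lborel (ereal 0) (ereal \<phi>) (jacobi_integrand m)"
proof
  assume int: "interval_lebesgue_integrable lborel (ereal 0) (ereal \<phi>) (jacobi_integrand m)"
  from m \<phi> have m1: "m = 1" and phi: "pi / 2 \<le> \<bar>\<phi>\<bar>" by (auto simp: amplitude_domain_def)
  \<comment> \<open>Reflection reduces a negative \<open>\<phi>\<close> to the singularity at
    \<open>pi / 2\<close>.\<close>
  have even: "(\<lambda>x. jacobi_integrand 1 (- x)) = jacobi_integrand 1"
    by (simp add: jacobi_integrand_def fun_eq_iff)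
  have "interval_lebesgue_integrable lborel (ereal 0) (ereal \<bar>\<phi>\<bar>) (jacobi_integrand 1)"
  proof (cases "0 \<le> \<phi>")
    case False
    have "interval_lebesgue_integrable lborel (- ereal 0) (- ereal \<bar>\<phi>\<bar>) (jacobi_integrand 1)"
      using int m1 False by simp
    then show ?thesis
      by (subst even[symmetric], subst interval_integrable_mirror, subst interval_integrable_endpoints_reverse)
  qed (use int m1 in simp)
  then have S: "set_integrable lborel {0<..<\<bar>\<phi>\<bar>} (jacobi_integrand 1)"
    by (simp only: interval_lebesgue_integrable_def einterval_eq ereal_less_eq abs_ge_zero if_True)
  \<comment> \<open>Integrability makes \<open>K\<close> a genuine upper bound for the integral on
    the whole of \<open>[0, pi / 2)\<close>.\<close>
  define K where "K = (LBINT t:{0<..<\<bar>\<phi>\<bar>}. jacobi_integrand 1 t)"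
  have bound: "elliptic_F 1 x \<le> K" if x: "0 \<le> x" "x < pi / 2" for x
  proof -
    have "elliptic_F 1 x = (LBINT t:{0<..<x}. jacobi_integrand 1 t)"
      using x by (simp only: elliptic_F_def interval_lebesgue_integral_def einterval_eq ereal_less_eq if_True)
    also have "\<dots> \<le> K"
      unfolding K_def set_lebesgue_integral_def
      using S x phi jacobi_integrand_nonneg[of 1]
      by (intro integral_mono') (auto simp: set_integrable_def indicator_def)
    finally show ?thesis .
  qed
  have K0: "0 \<le> K" using bound[of 0] by (simp add: elliptic_F_zero)
  \<comment> \<open>A preimage of a value above the bound; it is nonnegative because
    \<open>K + 1\<close> is positive, so \<open>bound\<close> applies and gives the
    contradiction.\<close>
  obtain x where x: "x \<in> amplitude_domain 1" "elliptic_F 1 x = K + 1"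
    using elliptic_F_surj[of 1 "K + 1"] by auto
  have "0 \<le> x"
  proof (rule ccontr)
    assume "\<not> 0 \<le> x"
    then have "elliptic_F 1 x < elliptic_F 1 0"
      using strict_mono_onD[OF elliptic_F_strict_mono[of 1] x(1) zero_in_amplitude_domain] by simp
    then show False using x K0 by (simp add: elliptic_F_zero)
  qed
  then have "elliptic_F 1 x \<le> K" using x by (intro bound) (auto simp: amplitude_domain_def)
  then show False using x by simp
qed

section \<open>The amplitude as the inverse of the elliptic integral\<close>

lemma jacobi_am_eqI:
  assumes m: "0 \<le> m" "m \<le> 1" and \<phi>: "\<phi> \<in> amplitude_domain m"
  shows "jacobi_am (elliptic_F m \<phi>) m = \<phi>"
  unfolding jacobi_am_def elliptic_F_def[symmetric]
proof (rule the_equality)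
  show "interval_lebesgue_integrable lborel (ereal 0) (ereal \<phi>) (jacobi_integrand m) \<and>
      elliptic_F m \<phi> = elliptic_F m \<phi>"
    using interval_integrable_jacobi_integrand[OF assms] by simp
next
  fix \<psi>
  assume "interval_lebesgue_integrable lborel (ereal 0) (ereal \<psi>) (jacobi_integrand m) \<and>
      elliptic_F m \<phi> = elliptic_F m \<psi>"
  \<comment> \<open>Integrability forces the competitor \<open>\<psi>\<close> into the domain, where
    strict monotonicity gives injectivity.\<close>
  then show "\<psi> = \<phi>"
    using not_interval_integrable_jacobi_integrand[OF m, of \<psi>] strict_mono_on_eqD[OF elliptic_F_strict_mono[OF m]] \<phi>
    by metis
qed

lemma jacobi_am_in_domain:
  assumes "0 \<le> m" "m \<le> 1"
  shows "jacobi_am v m \<in> amplitude_domain m"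
  using elliptic_F_surj[OF assms, of v] jacobi_am_eqI[OF assms] by metis

lemma elliptic_F_jacobi_am:
  assumes "0 \<le> m" "m \<le> 1"
  shows "elliptic_F m (jacobi_am v m) = v"
  using elliptic_F_surj[OF assms, of v] jacobi_am_eqI[OF assms] by metis

text \<open>Inverse function theorem for \<open>elliptic_F m\<close> on its open domain; the square
  root is the reciprocal of the integrand.\<close>

lemma jacobi_am_has_derivative:
  assumes m: "0 \<le> m" "m \<le> 1"
  shows "((\<lambda>v. jacobi_am v m) has_real_derivative sqrt (1 - m\<^sup>2 * (sin (jacobi_am v m))\<^sup>2)) (at v)"
proof -
  let ?D = "jacobi_integrand m (jacobi_am v m)"
  have dom: "jacobi_am v m \<in> amplitude_domain m" by (rule jacobi_am_in_domain[OF m])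
  have "((\<lambda>v. jacobi_am v m) has_derivative (*) (inverse ?D)) (at v)"
  proof (rule has_derivative_inverse_strong_x[where S = "amplitude_domain m" and f = "elliptic_F m"])
    show "continuous_on (amplitude_domain m) (elliptic_F m)"
      using elliptic_F_has_derivative[OF m] by (meson DERIV_isCont continuous_at_imp_continuous_on)
    show "(elliptic_F m has_derivative (*) ?D) (at (jacobi_am v m))"
      using elliptic_F_has_derivative[OF m dom] by (simp add: has_field_derivative_def)
    show "(*) ?D \<circ> (*) (inverse ?D) = id"
      using jacobi_integrand_pos[OF m dom] by (auto simp: fun_eq_iff)
  qed (simp_all add: open_amplitude_domain dom jacobi_am_eqI[OF m] elliptic_F_jacobi_am[OF m])
  then show ?thesis
    by (simp add: has_field_derivative_def jacobi_integrand_def)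
qed

section \<open>The third derivative of \<open>cn\<^sup>2\<close>\<close>

text \<open>Together with \<open>jacobi_dn\<close> this keeps all derivatives of
  \<open>jacobi_cn\<close> polynomial in three functions.\<close>

definition jacobi_sn :: "real \<Rightarrow> real \<Rightarrow> real" where
  "jacobi_sn v m = sin (jacobi_am v m)"

definition jacobi_dn :: "real \<Rightarrow> real \<Rightarrow> real" where
  "jacobi_dn v m = sqrt (1 - m\<^sup>2 * (jacobi_sn v m)\<^sup>2)"

lemma jacobi_sn_squared: "(jacobi_sn v m)\<^sup>2 = 1 - (jacobi_cn v m)\<^sup>2"
  by (simp add: jacobi_sn_def jacobi_cn_def sin_squared_eq)

lemma jacobi_dn_squared:
  assumes "0 \<le> m" "m \<le> 1"
  shows "(jacobi_dn v m)\<^sup>2 = 1 - m\<^sup>2 + m\<^sup>2 * (jacobi_cn v m)\<^sup>2"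
  using jacobi_radicand_pos[OF assms jacobi_am_in_domain[OF assms, of v]]
  by (simp add: jacobi_dn_def jacobi_sn_squared algebra_simps flip: jacobi_sn_def)

lemma jacobi_cn_has_derivative:
  assumes "0 \<le> m" "m \<le> 1"
  shows "((\<lambda>v. jacobi_cn v m) has_real_derivative - jacobi_sn v m * jacobi_dn v m) (at v)"
  unfolding jacobi_cn_def jacobi_sn_def jacobi_dn_def
  by (auto intro!: derivative_eq_intros jacobi_am_has_derivative assms)

lemma jacobi_sn_has_derivative:
  assumes "0 \<le> m" "m \<le> 1"
  shows "((\<lambda>v. jacobi_sn v m) has_real_derivative jacobi_cn v m * jacobi_dn v m) (at v)"
  unfolding jacobi_cn_def jacobi_sn_def jacobi_dn_def
  by (auto intro!: derivative_eq_intros jacobi_am_has_derivative assms)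

lemma jacobi_dn_has_derivative:
  assumes "0 \<le> m" "m \<le> 1"
  shows "((\<lambda>v. jacobi_dn v m) has_real_derivative - m\<^sup>2 * jacobi_sn v m * jacobi_cn v m) (at v)"
proof -
  have pos: "0 < 1 - m\<^sup>2 * (jacobi_sn v m)\<^sup>2"
    using jacobi_radicand_pos[OF assms jacobi_am_in_domain[OF assms]] by (simp add: jacobi_sn_def)
  have "((\<lambda>v. 1 - m\<^sup>2 * (jacobi_sn v m)\<^sup>2) has_real_derivative
      - 2 * m\<^sup>2 * jacobi_sn v m * jacobi_cn v m * jacobi_dn v m) (at v)"
    by (auto intro!: derivative_eq_intros jacobi_sn_has_derivative assms)
  from DERIV_chain2[OF DERIV_real_sqrt[OF pos] this] show ?thesis
    using pos by (simp add: jacobi_dn_def[abs_def] field_simps)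
qed

lemma cn_squared_has_derivative:
  assumes "0 \<le> m" "m \<le> 1"
  shows "((\<lambda>v. (jacobi_cn v m)\<^sup>2) has_real_derivative
    - 2 * jacobi_cn v m * jacobi_sn v m * jacobi_dn v m) (at v)"
  by (auto intro!: derivative_eq_intros jacobi_cn_has_derivative assms)

text \<open>After the product rule only even powers remain, so the two quadratic identities
  eliminate \<open>jacobi_sn\<close> and \<open>jacobi_dn\<close>, leaving a quadratic polynomial in
  the squared cn.\<close>

lemma cn_squared_has_second_derivative:
  assumes m: "0 \<le> m" "m \<le> 1"
  shows "((\<lambda>v. - 2 * jacobi_cn v m * jacobi_sn v m * jacobi_dn v m) has_real_derivative
    2 * ((1 - m\<^sup>2) + 2 * (2 * m\<^sup>2 - 1) * (jacobi_cn v m)\<^sup>2 - 3 * m\<^sup>2 * ((jacobi_cn v m)\<^sup>2)\<^sup>2)) (at v)"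
proof -
  let ?c = "jacobi_cn v m" and ?s = "jacobi_sn v m" and ?d = "jacobi_dn v m"
  have "((\<lambda>v. - 2 * jacobi_cn v m * jacobi_sn v m * jacobi_dn v m) has_real_derivative
      2 * ?s\<^sup>2 * ?d\<^sup>2 - 2 * ?c\<^sup>2 * ?d\<^sup>2 + 2 * m\<^sup>2 * ?c\<^sup>2 * ?s\<^sup>2) (at v)"
    by (auto intro!: derivative_eq_intros jacobi_cn_has_derivative jacobi_sn_has_derivative
        jacobi_dn_has_derivative m simp: algebra_simps power2_eq_square)
  also have "2 * ?s\<^sup>2 * ?d\<^sup>2 - 2 * ?c\<^sup>2 * ?d\<^sup>2 + 2 * m\<^sup>2 * ?c\<^sup>2 * ?s\<^sup>2 =
      2 * ((1 - m\<^sup>2) + 2 * (2 * m\<^sup>2 - 1) * ?c\<^sup>2 - 3 * m\<^sup>2 * (?c\<^sup>2)\<^sup>2)"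
    unfolding jacobi_sn_squared jacobi_dn_squared[OF m] by algebra
  finally show ?thesis .
qed

section \<open>Functions of \<open>x - \<sigma> t\<close>\<close>

text \<open>Reduces the system to ordinary differential equations for the profile. An equation
  between functions also rewrites inside iterated partial derivatives.\<close>

lemma partial_x_traveling:
  assumes "\<And>s. (f has_real_derivative f' s) (at s)"
  shows "partial_x (\<lambda>x t. f (x - \<sigma> * t)) = (\<lambda>x t. f' (x - \<sigma> * t))"
proof -
  have "((\<lambda>x. f (x - \<sigma> * t)) has_real_derivative f' (x - \<sigma> * t)) (at x)" for x t
    by (rule DERIV_chain2[where f = f, OF assms, THEN DERIV_cong]) (auto intro!: derivative_eq_intros)
  then show ?thesis
    by (simp add: partial_x_def fun_eq_iff DERIV_imp_deriv)
qed

lemma partial_t_traveling: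
  assumes "\<And>s. (f has_real_derivative f' s) (at s)"
  shows "partial_t (\<lambda>x t. f (x - \<sigma> * t)) = (\<lambda>x t. - \<sigma> * f' (x - \<sigma> * t))"
proof -
  have "((\<lambda>t. f (x - \<sigma> * t)) has_real_derivative - \<sigma> * f' (x - \<sigma> * t)) (at t)" for x t
    by (rule DERIV_chain2[where f = f, OF assms, THEN DERIV_cong]) (auto intro!: derivative_eq_intros)
  then show ?thesis
    by (simp add: partial_t_def fun_eq_iff DERIV_imp_deriv)
qed

lemma continuous_on_traveling:
  fixes g :: "real \<Rightarrow> real"
  assumes "continuous_on UNIV g"
  shows "continuous_on UNIV (\<lambda>(x, t). p * g (x - \<sigma> * t))"
proof -
  have "continuous_on UNIV (\<lambda>z::real \<times> real. fst z - \<sigma> * snd z)"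
    by (intro continuous_intros)
  then have "continuous_on UNIV (\<lambda>z. g (fst z - \<sigma> * snd z))"
    using continuous_on_compose2[OF assms] by blast
  then show ?thesis
    by (simp add: case_prod_beta continuous_on_mult_left)
qed

text \<open>The factor \<open>p\<close> makes the induction hypothesis cover time derivatives, which acquire a
  factor \<open>-\<sigma>\<close>.\<close>

lemma C_class_traveling:
  assumes "\<And>i s. i < n \<Longrightarrow> (g i has_real_derivative g (Suc i) s) (at s)"
    and "continuous_on UNIV (g n)"
  shows "C_class n (\<lambda>x t. p * g 0 (x - \<sigma> * t))"
  using assms
proof (induction n arbitrary: g p)
  case 0
  then show ?case
    by (simp add: continuous_on_traveling)
next
  case (Suc n)
  have d: "((\<lambda>s. p * g 0 s) has_real_derivative p * g 1 s) (at s)" for s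
    using Suc.prems(1)[of 0 s] by (auto intro!: derivative_eq_intros)
  \<comment> \<open>The shifted family starts at the derivative of the profile; \<open>q = p\<close>
    serves the space derivative and \<open>q = - \<sigma> * p\<close> the time derivative.\<close>
  have IH: "C_class n (\<lambda>x t. q * g 1 (x - \<sigma> * t))" for q
    using Suc.IH[of "\<lambda>i. g (Suc i)" q] Suc.prems by simp
  have "continuous_on UNIV (g 0)"
    using Suc.prems(1)[of 0] by (meson DERIV_isCont continuous_at_imp_continuous_on zero_less_Suc)
  then have cont: "continuous_on UNIV (\<lambda>(x, t). p * g 0 (x - \<sigma> * t))"
    by (rule continuous_on_traveling)
  have dx: "(\<lambda>y. p * g 0 (y - \<sigma> * t)) differentiable at x"
    and dt: "(\<lambda>s. p * g 0 (x - \<sigma> * s)) differentiable at t" for x t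
    unfolding real_differentiable_def
    by (rule exI, rule DERIV_chain2[where f = "\<lambda>s. p * g 0 s", OF d], auto intro!: derivative_eq_intros)+
  have px: "C_class n (partial_x (\<lambda>x t. p * g 0 (x - \<sigma> * t)))"
    unfolding partial_x_traveling[of "\<lambda>s. p * g 0 s", OF d] by (rule IH)
  have pt: "C_class n (partial_t (\<lambda>x t. p * g 0 (x - \<sigma> * t)))"
    unfolding partial_t_traveling[of "\<lambda>s. p * g 0 s", OF d]
    using IH[of "- \<sigma> * p"] by (simp add: mult.assoc)
  show ?case using cont dx dt px pt by simp
qed

section \<open>The semi-trivial cnoidal wave\<close>

theorem mainTheorem7:
  fixes a b c d lam \<sigma> m j0 k0 k1 k2 :: real
    and \<eta> w :: "real \<Rightarrow> real \<Rightarrow> real"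
  assumes "admissible a b c d"
    and "c \<noteq> 0" and "a = 0" and "b = 0"
    and "lam > 0" and "\<sigma> \<noteq> 0" and "0 < m" and "m \<le> 1"
    and "j0 = -1"
    and "k0 = - 8 * d * lam\<^sup>2 * m\<^sup>2 * \<sigma> + 4 * d * lam\<^sup>2 * \<sigma> + \<sigma>"
    and "k1 = 0"
    and "k2 = 12 * d * lam\<^sup>2 * m\<^sup>2 * \<sigma>"
    and "\<eta> = (\<lambda>x t. j0)"
    and "w = (\<lambda>x t. k0 + k2 * (jacobi_cn (lam * (x - \<sigma> * t)) m)\<^sup>2)"
  shows "abcd_solution a b c d \<eta> w \<and> traveling_wave \<sigma> \<eta> w \<and> semi_trivial \<eta> w"
proof -
  have m: "0 \<le> m" "m \<le> 1" using \<open>0 < m\<close> \<open>m \<le> 1\<close> by auto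
  define y where "y = (\<lambda>s. (jacobi_cn (lam * s) m)\<^sup>2)"
  \<comment> \<open>The derivative of cn squared in the elliptic argument; the chain rule factor
    \<open>lam\<close> is kept apart. Below, \<open>f1\<close>, \<open>f2\<close>, \<open>f3\<close>
    are the successive derivatives of the profile \<open>f\<close>.\<close>
  define y1 where "y1 = (\<lambda>s. - 2 * jacobi_cn (lam * s) m * jacobi_sn (lam * s) m * jacobi_dn (lam * s) m)"
  define f where "f = (\<lambda>s. k0 + k2 * y s)"
  define f1 where "f1 = (\<lambda>s. k2 * lam * y1 s)"
  define f2 where "f2 = (\<lambda>s. 2 * k2 * lam\<^sup>2 * ((1 - m\<^sup>2) + 2 * (2 * m\<^sup>2 - 1) * y s - 3 * m\<^sup>2 * (y s)\<^sup>2))"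
  define f3 where "f3 = (\<lambda>s. 4 * k2 * lam ^ 3 * ((2 * m\<^sup>2 - 1) - 3 * m\<^sup>2 * y s) * y1 s)"
  have scale: "((\<lambda>s. h (lam * s)) has_real_derivative lam * D) (at s)"
    if "(h has_real_derivative D) (at (lam * s))" for h D s
    by (rule DERIV_chain2[where f = h and g = "\<lambda>s. lam * s", OF that, THEN DERIV_cong]) (auto intro!: derivative_eq_intros)
  have dy: "(y has_real_derivative lam * y1 s) (at s)" for s
    unfolding y_def y1_def by (rule scale, rule cn_squared_has_derivative[OF m])
  have dy1: "(y1 has_real_derivative
      lam * (2 * ((1 - m\<^sup>2) + 2 * (2 * m\<^sup>2 - 1) * y s - 3 * m\<^sup>2 * (y s)\<^sup>2))) (at s)" for s
    unfolding y_def y1_def by (rule scale, rule cn_squared_has_second_derivative[OF m])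
  have df: "(f has_real_derivative f1 s) (at s)" for s
    unfolding f_def f1_def by (auto intro!: derivative_eq_intros dy)
  have df1: "(f1 has_real_derivative f2 s) (at s)" for s
    unfolding f1_def f2_def by (auto intro!: derivative_eq_intros dy1 simp: power2_eq_square)
  have df2: "(f2 has_real_derivative f3 s) (at s)" for s
    unfolding f2_def f3_def
    by (auto intro!: derivative_eq_intros dy simp: power2_eq_square power3_eq_cube algebra_simps)
  have cont3: "continuous_on UNIV f3"
    unfolding f3_def using dy dy1
    by (intro continuous_intros) (meson DERIV_isCont continuous_at_imp_continuous_on)+
  have w: "w = (\<lambda>x t. f (x - \<sigma> * t))" by (simp add: assms(14) f_def y_def)
  define g where "g = (!) [f, f1, f2, f3]"
  have "C_class 3 (\<lambda>x t. 1 * g 0 (x - \<sigma> * t))"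
  proof (rule C_class_traveling)
    fix i :: nat and s assume "i < 3"
    then consider "i = 0" | "i = 1" | "i = 2" by linarith
    then show "(g i has_real_derivative g (Suc i) s) (at s)"
      by cases (simp_all add: g_def df df1 df2 numeral_2_eq_2)
  qed (simp add: g_def cont3)
  then have Cw: "C_class 3 w" by (simp add: w g_def)
  have C\<eta>: "C_class 3 \<eta>"
    \<comment> \<open>A constant profile followed by zero derivatives; it is a wave of any speed,
      here 0.\<close>
    using C_class_traveling[of 3 "\<lambda>i _. if i = 0 then j0 else 0" 1 0]
    by (simp add: assms(13))
  have px: "partial_x w = (\<lambda>x t. f1 (x - \<sigma> * t))"
    unfolding w by (rule partial_x_traveling[OF df])
  have pxx: "partial_x (\<lambda>x t. f1 (x - \<sigma> * t)) = (\<lambda>x t. f2 (x - \<sigma> * t))"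
    by (rule partial_x_traveling[OF df1])
  have pxxt: "partial_t (\<lambda>x t. f2 (x - \<sigma> * t)) = (\<lambda>x t. - \<sigma> * f3 (x - \<sigma> * t))"
    by (rule partial_t_traveling[OF df2])
  have pt: "partial_t w = (\<lambda>x t. - \<sigma> * f1 (x - \<sigma> * t))"
    unfolding w by (rule partial_t_traveling[OF df])
  \<comment> \<open>The product is \<open>- w\<close>, because \<open>\<eta>\<close> is -1.\<close>
  have pw\<eta>: "partial_x (\<lambda>x t. w x t * \<eta> x t) = (\<lambda>x t. - f1 (x - \<sigma> * t))"
    using partial_x_traveling[of "\<lambda>s. - f s" "\<lambda>s. - f1 s" \<sigma>] DERIV_minus[OF df]
    by (simp add: w assms(9,13))
  have p\<eta>: "partial_x \<eta> = (\<lambda>x t. 0)" "partial_t \<eta> = (\<lambda>x t. 0)" "partial_x (\<lambda>x t. 0) = (\<lambda>x t. 0)"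
    by (simp_all add: assms(13) partial_x_def partial_t_def fun_eq_iff)
  \<comment> \<open>After extracting \<open>k2 * lam * y1 s\<close>, the coefficient of
    \<open>y s\<close> is \<open>k2 - 12 * d * \<sigma> * lam\<^sup>2 * m\<^sup>2\<close> and the
    constant term is \<open>k0 - \<sigma> + 4 * d * \<sigma> * lam\<^sup>2 * (2 * m\<^sup>2 -
    1)\<close>; both vanish.\<close>
  have ode: "- \<sigma> * f1 s + f s * f1 s + d * \<sigma> * f3 s = 0" for s
    unfolding f_def f1_def f3_def assms(10,12) by algebra
  have "abcd_solution a b c d \<eta> w"
    unfolding abcd_solution_def pw\<eta> px pxx pxxt pt p\<eta>
  proof (intro conjI allI Cw C\<eta>)
    fix x t
    show "- \<sigma> * f1 (x - \<sigma> * t) + 0 + w x t * f1 (x - \<sigma> * t) + c * 0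
        - d * (- \<sigma> * f3 (x - \<sigma> * t)) = 0"
      using ode[of "x - \<sigma> * t"] by (simp add: w)
  \<comment> \<open>The first equation remains: its third-order terms carry the factors
    \<open>a\<close> and \<open>b\<close>, and the other terms cancel.\<close>
  qed (simp add: \<open>a = 0\<close> \<open>b = 0\<close>)
  moreover have "traveling_wave \<sigma> \<eta> w"
    unfolding traveling_wave_def w assms(13) by (intro exI[of _ "\<lambda>_. j0"] exI[of _ f]) simp
  moreover have "semi_trivial \<eta> w"
    unfolding semi_trivial_def assms(13) by blast
  ultimately show ?thesis by blast
qed

end
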